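(* Let $n=p_1^{m_1}\cdots p_k^{m_k}$, where $k\geq 1$, $p_1,\ldots,p_k$ are distinct prime numbers and $m_i\geq1$. Then the following statements hold. (1) If $k=1$, then $\operatorname{Iso}(GD(\mathbb Z_n))=\{[\overline{p_1}]\}$ if $m_1=2$, and $\operatorname{Iso}(GD(\mathbb Z_n))=\emptyset$ if $m_1\neq2$. (2) If $k\geq2$, then $\operatorname{Iso}(GD(\mathbb Z_n))=\{[\overline{p_i}]:m_i=1\}$. (3) For the ordinary divisor topology, $\operatorname{Iso}(D(\mathbb Z_n))=\emptyset$ if $n$ is prime, and $\operatorname{Iso}(D(\mathbb Z_n))=\{[\overline{p_i}]:1\leq i\leq k\}$ if $n$ is composite.
   Context: For a commutative ring $R$ with nonzero identity and unit group $U(R)$, let $R^\#=R\setminus(U(R)\cup\{0\})$ be the set of nonzero nonunits. For $a,b\in R^\#$ write $a\sim b$ if $aR=bR$; $[a]$ denotes the equivalence class of $a$ and $EC(R^\#)$ the set of equivalence classes. For $a\in R^\#$ put $B_a=\{[b]\in EC(R^\#): b\mid a^n\text{ for some }n\geq 1\}$ and $U_a=\{[b]\in EC(R^\#): b\mid a\}$. The sets $B_a$ ($a\in R^\#$) form a basis of a topology on $EC(R^\#)$, denoted $GD(R)$ (the generalized divisor topology), and the sets $U_a$ ($a\in R^\#$) form a basis of a topology on $EC(R^\#)$, denoted $D(R)$ (the divisor topology). $\operatorname{Iso}(X)$ denotes the set of isolated points of a topological space $X$. $\mathbb Z_n=\mathbb Z/n\mathbb Z$ and $\overline{x}$ is the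 residue class of $x$ modulo $n$. *)

theory Defs
  imports "HOL-Algebra.IntRing" "HOL-Algebra.Divisibility" "HOL-Analysis.Abstract_Topology"
begin

definition nz_nonunits :: "('a, 'b) ring_scheme \<Rightarrow> 'a set"
  where "nz_nonunits R = carrier R - (Units R \<union> {\<zero>\<^bsub>R\<^esub>})"

definition pideal_rel :: "('a, 'b) ring_scheme \<Rightarrow> ('a \<times> 'a) set"
  where "pideal_rel R = {(a, b). a \<in> nz_nonunits R \<and> b \<in> nz_nonunits R \<and> PIdl\<^bsub>R\<^esub> a = PIdl\<^bsub>R\<^esub> b}"

definition ec :: "('a, 'b) ring_scheme \<Rightarrow> 'a \<Rightarrow> 'a set"
  where "ec R a = pideal_rel R `` {a}"

definition EC :: "('a, 'b) ring_scheme \<Rightarrow> 'a set set"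
  where "EC R = nz_nonunits R // pideal_rel R"

definition gd_basic :: "('a, 'b) ring_scheme \<Rightarrow> 'a \<Rightarrow> 'a set set"
  where "gd_basic R a =
    {ec R b | b. b \<in> nz_nonunits R \<and> (\<exists>n::nat. n \<ge> 1 \<and> b divides\<^bsub>R\<^esub> (a [^]\<^bsub>R\<^esub> n))}"

definition d_basic :: "('a, 'b) ring_scheme \<Rightarrow> 'a \<Rightarrow> 'a set set"
  where "d_basic R a = {ec R b | b. b \<in> nz_nonunits R \<and> b divides\<^bsub>R\<^esub> a}"

text \<open>\<^const>\<open>topology\<close> is meaningful only on predicates satisfying \<^const>\<open>istopology\<close>;
  this is shown for both definitions, over any commutative ring, at the end of the theory.\<close>

definition GD :: "('a, 'b) ring_scheme \<Rightarrow> 'a set topology"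
  where "GD R = topology (arbitrary union_of (\<lambda>U. U \<in> gd_basic R ` nz_nonunits R))"

definition D :: "('a, 'b) ring_scheme \<Rightarrow> 'a set topology"
  where "D R = topology (arbitrary union_of (\<lambda>U. U \<in> d_basic R ` nz_nonunits R))"

definition Iso :: "'a topology \<Rightarrow> 'a set"
  where "Iso X = {x \<in> topspace X. openin X {x}}"

lemma EC_eq: "EC R = ec R ` nz_nonunits R"
  by (auto simp: EC_def ec_def quotient_def)

context cring
begin

lemma ec_eqD:
  assumes "ec R b = ec R c" "b \<in> nz_nonunits R" "c \<in> nz_nonunits R"
  shows "b divides c"
proof -
  have "c \<in> ec R c" using assms(3) by (simp add: ec_def pideal_rel_def)
  hence "PIdl b = PIdl c" using assms(1) by (auto simp: ec_def pideal_rel_def)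
  moreover have "c \<in> PIdl c" using assms(3) by (simp add: cgenideal_self nz_nonunits_def)
  ultimately obtain x where "x \<in> carrier R" "c = x \<otimes> b" by (auto simp: cgenideal_def)
  thus ?thesis using assms(2) m_comm by (auto simp: factor_def nz_nonunits_def)
qed

lemma divides_pow_trans:
  assumes "a \<in> carrier R" "b \<in> carrier R" "c \<in> carrier R"
    and "b divides a [^] (n::nat)" "c divides b [^] (m::nat)"
  shows "c divides a [^] (n * m)"
proof -
  obtain d where d: "d \<in> carrier R" "a [^] n = b \<otimes> d" using assms(4) by (auto simp: factor_def)
  obtain e where e: "e \<in> carrier R" "b [^] m = c \<otimes> e" using assms(5) by (auto simp: factor_def)
  have "a [^] (n * m) = (b \<otimes> d) [^] m" using assms d by (metis nat_pow_pow)
  also have "\<dots> = c \<otimes> (e \<otimes> d [^] m)" using assms d e by (simp add: nat_pow_distrib m_assoc)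
  finally show ?thesis using d e by (auto simp: factor_def)
qed

lemma ec_in_gd_basic_iff:
  assumes "a \<in> nz_nonunits R" "b \<in> nz_nonunits R"
  shows "ec R b \<in> gd_basic R a \<longleftrightarrow> (\<exists>n::nat. n \<ge> 1 \<and> b divides (a [^] n))"
proof
  assume "ec R b \<in> gd_basic R a"
  then obtain c n where c: "c \<in> nz_nonunits R" "ec R b = ec R c" "n \<ge> 1" "c divides (a [^] (n::nat))"
    by (auto simp: gd_basic_def)
  moreover have "b divides c" using ec_eqD c assms by blast
  ultimately show "\<exists>n::nat. n \<ge> 1 \<and> b divides (a [^] n)"
    using assms divides_trans by (metis DiffD1 nz_nonunits_def)
qed (use assms in \<open>auto simp: gd_basic_def\<close>)

lemma ec_in_d_basic_iff:
  assumes "a \<in> nz_nonunits R" "b \<in> nz_nonunits R"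
  shows "ec R b \<in> d_basic R a \<longleftrightarrow> b divides a"
proof
  assume "ec R b \<in> d_basic R a"
  then obtain c where c: "c \<in> nz_nonunits R" "ec R b = ec R c" "c divides a"
    by (auto simp: d_basic_def)
  moreover have "b divides c" using ec_eqD c assms by blast
  ultimately show "b divides a"
    using assms divides_trans by (metis DiffD1 nz_nonunits_def)
qed (use assms in \<open>auto simp: d_basic_def\<close>)

lemma ec_in_gd_basic_self: "a \<in> nz_nonunits R \<Longrightarrow> ec R a \<in> gd_basic R a"
  unfolding gd_basic_def nz_nonunits_def
  by (auto intro!: exI[of _ a] exI[of _ "1::nat"] simp: divides_refl)

lemma ec_in_d_basic_self: "a \<in> nz_nonunits R \<Longrightarrow> ec R a \<in> d_basic R a"
  unfolding d_basic_def nz_nonunits_def by (auto simp: divides_refl)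

lemma gd_basic_mono:
  assumes "a \<in> nz_nonunits R" "b \<in> nz_nonunits R" "ec R b \<in> gd_basic R a"
  shows "gd_basic R b \<subseteq> gd_basic R a"
proof
  fix x assume "x \<in> gd_basic R b"
  then obtain c m where c: "c \<in> nz_nonunits R" "x = ec R c" "m \<ge> 1" "c divides (b [^] (m::nat))"
    by (auto simp: gd_basic_def)
  obtain n where n: "n \<ge> 1" "b divides (a [^] (n::nat))"
    using assms ec_in_gd_basic_iff by blast
  have "c divides a [^] (n * m)"
    using divides_pow_trans[of a b c n m] assms c n by (auto simp: nz_nonunits_def)
  moreover have "n * m \<ge> 1" using n c by simp
  ultimately show "x \<in> gd_basic R a" using c unfolding gd_basic_def by blast
qed

lemma d_basic_mono:
  assumes "a \<in> nz_nonunits R" "b \<in> nz_nonunits R" "ec R b \<in> d_basic R a"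
  shows "d_basic R b \<subseteq> d_basic R a"
proof
  fix x assume "x \<in> d_basic R b"
  then obtain c where c: "c \<in> nz_nonunits R" "x = ec R c" "c divides b"
    by (auto simp: d_basic_def)
  moreover have "b divides a" using assms ec_in_d_basic_iff by blast
  ultimately have "c divides a" using divides_trans by (metis DiffD1 nz_nonunits_def)
  thus "x \<in> d_basic R a" using c unfolding d_basic_def by blast
qed

lemma istopology_basic:
  assumes sub: "\<And>a. a \<in> N \<Longrightarrow> F a \<subseteq> f ` N"
    and self: "\<And>a. a \<in> N \<Longrightarrow> f a \<in> F a"
    and mono: "\<And>a b. a \<in> N \<Longrightarrow> b \<in> N \<Longrightarrow> f b \<in> F a \<Longrightarrow> F b \<subseteq> F a"
  shows "istopology (arbitrary union_of (\<lambda>U. U \<in> F ` N))"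
  unfolding istopology_base_eq
proof (intro allI impI, elim conjE imageE)
  fix S T a b assume ab: "S = F a" "a \<in> N" "T = F b" "b \<in> N"
  let ?\<U> = "F ` {c \<in> N. f c \<in> F a \<inter> F b}"
  have "\<Union>?\<U> \<subseteq> F a \<inter> F b" using mono ab by blast
  moreover have "F a \<inter> F b \<subseteq> \<Union>?\<U>"
  proof
    fix x assume x: "x \<in> F a \<inter> F b"
    then obtain c where "c \<in> N" "x = f c" using sub ab by blast
    thus "x \<in> \<Union>?\<U>" using x self by blast
  qed
  ultimately have "\<Union>?\<U> = S \<inter> T" using ab by blast
  moreover have "?\<U> \<subseteq> Collect (\<lambda>U. U \<in> F ` N)" by blast
  ultimately show "(arbitrary union_of (\<lambda>U. U \<in> F ` N)) (S \<inter> T)"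
    unfolding union_of_def arbitrary_def by blast
qed

lemma openin_GD: "openin (GD R) = arbitrary union_of (\<lambda>U. U \<in> gd_basic R ` nz_nonunits R)"
proof -
  have "istopology (arbitrary union_of (\<lambda>U. U \<in> gd_basic R ` nz_nonunits R))"
    by (rule istopology_basic[where f = "ec R", OF _ ec_in_gd_basic_self gd_basic_mono])
      (auto simp: gd_basic_def)
  thus ?thesis by (simp add: GD_def)
qed

lemma openin_D: "openin (D R) = arbitrary union_of (\<lambda>U. U \<in> d_basic R ` nz_nonunits R)"
proof -
  have "istopology (arbitrary union_of (\<lambda>U. U \<in> d_basic R ` nz_nonunits R))"
    by (rule istopology_basic[where f = "ec R", OF _ ec_in_d_basic_self d_basic_mono])
      (auto simp: d_basic_def)
  thus ?thesis by (simp add: D_def)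
qed

lemma topspace_union_of: "openin X = arbitrary union_of (\<lambda>U. U \<in> \<B>) \<Longrightarrow> topspace X = \<Union>\<B>"
  by (auto simp: topspace_def union_of_def arbitrary_def)

lemma topspace_GD: "topspace (GD R) = EC R"
  using topspace_union_of[OF openin_GD] ec_in_gd_basic_self
  by (auto simp: EC_eq gd_basic_def) 

lemma topspace_D: "topspace (D R) = EC R"
  using topspace_union_of[OF openin_D] ec_in_d_basic_self
  by (auto simp: EC_eq d_basic_def)

end

end

theory Submission
  imports Defs
begin

text \<open>Divisibility in \<open>\<int>/N\<close> is divisibility by greatest common divisors in \<open>\<int>\<close>: the class of
  \<open>b\<close> divides the class of \<open>a\<close> iff \<open>gcd b N\<close> divides \<open>a\<close>. So the point \<open>[a]\<close> of either space is
  the divisor \<open>gcd a N\<close> of \<open>N\<close>, and every divisor other than \<open>1\<close> and \<open>N\<close> occurs.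

  In both topologies \<open>[a]\<close> has a least neighbourhood, the basic set of \<open>a\<close>, so \<open>[a]\<close> is isolated
  iff this set is \<open>{[a]}\<close>. Let \<open>a\<close> be a nonzero nonunit modulo \<open>N\<close>. Some prime \<open>q\<close> divides
  \<open>gcd a N\<close>; its class is again nonzero and a nonunit, and lies in the basic set of \<open>a\<close>. Hence an
  isolated point is always the class of a prime \<open>q\<close> with \<open>q dvd N\<close> and \<open>\<not> N dvd q\<close>.

  For the divisor topology every such class is isolated, since a prime has no smaller divisor
  than itself apart from \<open>1\<close> (\<open>Iso_D_ZFact\<close>). For the generalized divisor topology the basic set
  of \<open>q\<close> consists of the powers of \<open>q\<close> dividing \<open>N\<close>, other than \<open>1\<close> and \<open>N\<close>. The second power
  is such a point unless \<open>q\<^sup>2\<close> does not divide \<open>N\<close> or equals \<open>N\<close>, which gives the condition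
  \<open>q\<^sup>2 dvd N \<longrightarrow> N = q\<^sup>2\<close> (\<open>Iso_GD_ZFact\<close>).

  Neither description mentions the factorization of \<open>N\<close>. The trichotomy in the theorem comes from
  evaluating the conditions for \<open>N = \<Prod>p\<^sub>i ^ m\<^sub>i\<close>: \<open>p\<^sub>i\<^sup>2 dvd N\<close> means \<open>m\<^sub>i \<ge> 2\<close>, while \<open>N = p\<^sub>i\<close> and
  \<open>N = p\<^sub>i\<^sup>2\<close> are possible only when there is a single prime.\<close>

section \<open>Isolated points of divisor topologies over a commutative ring\<close>

text \<open>If the basis is indexed by the points that its members are built around, an isolated point
  \<open>x\<close> forces a basic set \<open>F a = {x}\<close>, and this set contains \<open>f a\<close>; so \<open>x\<close> can only be \<open>f a\<close>.\<close>

lemma Iso_base_eq: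
  assumes "openin X = arbitrary union_of (\<lambda>U. U \<in> F ` N)"
    and self: "\<And>a. a \<in> N \<Longrightarrow> f a \<in> F a"
  shows "Iso X = f ` {a \<in> N. F a = {f a}}"
proof -
  have "openin X {x} \<longleftrightarrow> {x} \<in> F ` N" for x
  proof
    assume "openin X {x}"
    then obtain \<U> where \<U>: "\<U> \<subseteq> F ` N" "\<Union>\<U> = {x}"
      unfolding assms(1) union_of_def by auto
    then obtain U where U: "U \<in> \<U>" "x \<in> U" by blast
    with \<U>(2) have "U = {x}" by blast
    with U \<U> show "{x} \<in> F ` N" by blast
  next
    assume "{x} \<in> F ` N"
    thus "openin X {x}"
      unfolding assms(1) union_of_def arbitrary_def by (intro exI[of _ "{{x}}"]) auto
  qed
  hence "Iso X = {x. {x} \<in> F ` N}" by (auto simp: Iso_def dest: openin_subset)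
  also have "\<dots> = f ` {a \<in> N. F a = {f a}}"
  proof (intro equalityI subsetI)
    fix x assume "x \<in> {x. {x} \<in> F ` N}"
    then obtain a where a: "a \<in> N" "F a = {x}" by auto
    hence "f a = x" using self by auto
    thus "x \<in> f ` {a \<in> N. F a = {f a}}" using a by blast
  next
    fix x assume "x \<in> f ` {a \<in> N. F a = {f a}}"
    then obtain a where "a \<in> N" "F a = {x}" by auto
    thus "x \<in> {x. {x} \<in> F ` N}" by (metis (mono_tags) imageI mem_Collect_eq)
  qed
  finally show ?thesis .
qed

context cring
begin

text \<open>Equal principal ideals amount to mutual divisibility, which is what the arithmetic of
  \<open>\<int>/N\<close> can decide.\<close>

lemma ec_eq_iff:
  assumes "a \<in> nz_nonunits R" "b \<in> nz_nonunits R"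
  shows "ec R a = ec R b \<longleftrightarrow> a divides b \<and> b divides a"
proof
  have sub: "PIdl y \<subseteq> PIdl x"
    if x: "x \<in> nz_nonunits R" and xy: "x divides y" for x y
  proof -
    obtain c where "c \<in> carrier R" "y = x \<otimes> c" using xy unfolding factor_def by blast
    then show ?thesis
      using x by (intro cgenideal_minimal cgenideal_ideal)
        (auto simp: nz_nonunits_def cgenideal_def m_comm)
  qed
  assume "a divides b \<and> b divides a"
  hence "PIdl a = PIdl b" using sub assms by blast
  thus "ec R a = ec R b" using assms by (auto simp: ec_def pideal_rel_def)
qed (use assms in \<open>auto intro: ec_eqD\<close>)

lemma Iso_D_eq:
  "Iso (D R) = ec R ` {a \<in> nz_nonunits R. \<forall>b \<in> nz_nonunits R. b divides a \<longrightarrow> a divides b}"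
proof -
  have "d_basic R a = {ec R a} \<longleftrightarrow> (\<forall>b \<in> nz_nonunits R. b divides a \<longrightarrow> a divides b)"
    if "a \<in> nz_nonunits R" for a
  proof -
    have "d_basic R a = {ec R a} \<longleftrightarrow> (\<forall>b \<in> nz_nonunits R. b divides a \<longrightarrow> ec R b = ec R a)"
      using ec_in_d_basic_self[OF that] by (auto simp: d_basic_def)
    thus ?thesis using ec_eq_iff that by metis
  qed
  thus ?thesis
    using Iso_base_eq[where f = "ec R", OF openin_D ec_in_d_basic_self]
    by (simp cong: conj_cong)
qed

text \<open>Unlike for the divisor topology, \<open>b divides a\<close> has to appear in the conclusion: it does not
  follow from \<open>b divides a [^] j\<close>, and it is the part that excludes squares of primes later.\<close>

lemma Iso_GD_eq:
  "Iso (GD R) = ec R ` {a \<in> nz_nonunits R. \<forall>b \<in> nz_nonunits R. \<forall>j::nat.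
     1 \<le> j \<longrightarrow> b divides a [^] j \<longrightarrow> a divides b \<and> b divides a}"
proof -
  have "gd_basic R a = {ec R a} \<longleftrightarrow> (\<forall>b \<in> nz_nonunits R. \<forall>j::nat.
     1 \<le> j \<longrightarrow> b divides a [^] j \<longrightarrow> a divides b \<and> b divides a)"
    if "a \<in> nz_nonunits R" for a
  proof -
    have "gd_basic R a = {ec R a} \<longleftrightarrow> (\<forall>b \<in> nz_nonunits R. \<forall>j::nat.
       1 \<le> j \<longrightarrow> b divides a [^] j \<longrightarrow> ec R b = ec R a)"
      using ec_in_gd_basic_self[OF that] by (auto simp: gd_basic_def)
    thus ?thesis using ec_eq_iff that by metis
  qed
  thus ?thesis
    using Iso_base_eq[where f = "ec R", OF openin_GD ec_in_gd_basic_self]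
    by (simp cong: conj_cong)
qed

end

section \<open>Divisibility in the quotients of the integers\<close>

lemma ZMod_ring_hom: "ring_hom_ring \<Z> (ZFact N) (ZMod N)"
  using ideal.rcos_ring_hom_ring[OF int.genideal_ideal[of "{N}"]]
  by (simp add: ZFact_def ZMod_def[abs_def])

lemma carrier_ZFact: "carrier (ZFact N) = range (ZMod N)"
  by (auto simp: ZFact_def FactRing_def A_RCOSETS_def' ZMod_def)

lemma ZMod_mult: "ZMod N a \<otimes>\<^bsub>ZFact N\<^esub> ZMod N b = ZMod N (a * b)"
  using ring_hom_ring.homh[OF ZMod_ring_hom] ring_hom_mult[of "ZMod N" \<Z> "ZFact N" a b]
  by simp

lemma ZMod_one: "\<one>\<^bsub>ZFact N\<^esub> = ZMod N 1"
  using ring_hom_ring.homh[OF ZMod_ring_hom] ring_hom_one[of "ZMod N" \<Z> "ZFact N"]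
  by simp

lemma ZMod_zero: "\<zero>\<^bsub>ZFact N\<^esub> = ZMod N 0"
  using ring_hom_zero[OF ring_hom_ring.homh[OF ZMod_ring_hom]] int.ring_axioms
    cring.axioms(1)[OF ZFact_is_cring]
  by simp

lemma ZMod_pow: "ZMod N a [^]\<^bsub>ZFact N\<^esub> (j::nat) = ZMod N (a ^ j)"
  by (induction j) (simp_all add: ZMod_one ZMod_mult nat_pow_def mult.commute)

lemma ZMod_eq_iff_dvd_diff: "ZMod N a = ZMod N b \<longleftrightarrow> N dvd a - b"
  by (simp add: ZMod_eq_mod mod_eq_dvd_iff)

text \<open>By Bezout, the ideal of \<open>\<int>\<close> generated by \<open>b\<close> and \<open>N\<close> is generated by \<open>gcd b N\<close>, and \<open>a\<close> lies
  in it exactly when \<open>a\<close> is a multiple of \<open>b\<close> modulo \<open>N\<close>.\<close>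

lemma ZMod_divides_iff:
  "ZMod N b divides\<^bsub>ZFact N\<^esub> ZMod N a \<longleftrightarrow> gcd b N dvd a"
proof
  assume "ZMod N b divides\<^bsub>ZFact N\<^esub> ZMod N a"
  then obtain c where "N dvd a - b * c"
    by (auto simp: factor_def carrier_ZFact ZMod_mult ZMod_eq_iff_dvd_diff)
  hence "gcd b N dvd (a - b * c) + b * c" by (meson dvd_add dvd_mult2 dvd_trans gcd_dvd1 gcd_dvd2)
  thus "gcd b N dvd a" by simp
next
  assume "gcd b N dvd a"
  then obtain t where t: "a = gcd b N * t" ..
  obtain u v where uv: "u * b + v * N = gcd b N" using bezout_int by blast
  have "a = (u * b + v * N) * t" using t uv by simp
  hence "a - b * (u * t) = N * (v * t)" by (simp add: algebra_simps)
  hence "ZMod N a = ZMod N b \<otimes>\<^bsub>ZFact N\<^esub> ZMod N (u * t)"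
    by (simp add: ZMod_mult ZMod_eq_iff_dvd_diff)
  thus "ZMod N b divides\<^bsub>ZFact N\<^esub> ZMod N a"
    by (auto simp: factor_def carrier_ZFact)
qed

lemma ZMod_nz_nonunit_iff:
  "ZMod N a \<in> nz_nonunits (ZFact N) \<longleftrightarrow> gcd a N \<noteq> 1 \<and> \<not> N dvd a"
proof -
  interpret Z: cring "ZFact N" by (rule ZFact_is_cring)
  have "ZMod N a \<in> Units (ZFact N) \<longleftrightarrow> gcd a N = 1"
    by (simp add: Z.Unit_eq_dividesone carrier_ZFact) (simp add: ZMod_one ZMod_divides_iff)
  moreover have "ZMod N a = \<zero>\<^bsub>ZFact N\<^esub> \<longleftrightarrow> N dvd a"
    by (simp add: ZMod_zero ZMod_eq_iff_dvd_diff)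
  ultimately show ?thesis by (auto simp: nz_nonunits_def carrier_ZFact)
qed

lemma nz_nonunits_ZFact:
  "nz_nonunits (ZFact N) = ZMod N ` {a. gcd a N \<noteq> 1 \<and> \<not> N dvd a}"
  using ZMod_nz_nonunit_iff by (auto simp: carrier_ZFact nz_nonunits_def)

section \<open>Isolated points as classes of primes\<close>

lemma Iso_D_ZFact_by_gcd:
  "Iso (D (ZFact N)) = (\<lambda>a. ec (ZFact N) (ZMod N a)) `
     {a. gcd a N \<noteq> 1 \<and> \<not> N dvd a \<and>
         (\<forall>b. gcd b N \<noteq> 1 \<longrightarrow> \<not> N dvd b \<longrightarrow> gcd b N dvd a \<longrightarrow> gcd a N dvd b)}"
  unfolding cring.Iso_D_eq[OF ZFact_is_cring] nz_nonunits_ZFact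
  by (simp add: Compr_image_eq image_image imp_conjL ZMod_divides_iff)

lemma Iso_GD_ZFact_by_gcd:
  "Iso (GD (ZFact N)) = (\<lambda>a. ec (ZFact N) (ZMod N a)) `
     {a. gcd a N \<noteq> 1 \<and> \<not> N dvd a \<and>
         (\<forall>b. gcd b N \<noteq> 1 \<longrightarrow> \<not> N dvd b \<longrightarrow>
            (\<forall>j\<ge>1. gcd b N dvd a ^ j \<longrightarrow> gcd a N dvd b \<and> gcd b N dvd a))}"
  unfolding cring.Iso_GD_eq[OF ZFact_is_cring] nz_nonunits_ZFact
  by (simp add: Compr_image_eq image_image imp_conjL ZMod_divides_iff ZMod_pow)

lemma ec_ZMod_eq_iff:
  assumes "gcd a N \<noteq> 1" "\<not> N dvd a" "gcd b N \<noteq> 1" "\<not> N dvd b"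
  shows "ec (ZFact N) (ZMod N a) = ec (ZFact N) (ZMod N b) \<longleftrightarrow> gcd a N dvd b \<and> gcd b N dvd a"
  using assms
  by (simp add: cring.ec_eq_iff[OF ZFact_is_cring] ZMod_nz_nonunit_iff ZMod_divides_iff)

text \<open>Below every point lies the class of a prime: the prime \<open>q\<close> is not a multiple of \<open>N\<close> because
  its multiple \<open>a\<close> is not.\<close>

lemma prime_factor_of_gcd:
  fixes a N :: int
  assumes "gcd a N \<noteq> 1" "\<not> N dvd a"
  obtains q where "Factorial_Ring.prime q" "q dvd N" "q dvd a" "gcd q N = q" "\<not> N dvd q"
proof -
  have "\<not> is_unit (gcd a N)" using assms by simp
  moreover have "gcd a N \<noteq> 0" using assms by auto
  ultimately obtain q where q: "Factorial_Ring.prime q" "q dvd gcd a N"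
    using prime_divisor_exists by blast
  hence "q dvd N" "q dvd a" by auto
  moreover have "gcd q N = q" using \<open>q dvd N\<close> q(1) prime_ge_0_int[of q] by (simp add: gcd_proj1_iff)
  moreover have "\<not> N dvd q" using assms(2) \<open>q dvd a\<close> dvd_trans by blast
  ultimately show thesis using that q(1) by blast
qed

lemma prime_dvd_if_gcd_dvd_prime:
  fixes b q N :: int
  assumes "Factorial_Ring.prime q" "gcd b N dvd q" "gcd b N \<noteq> 1"
  shows "q dvd b"
proof -
  have "gcd b N = q"
    using assms by (metis gcd_ge_0_int prime_int_iff)
  thus ?thesis by (metis gcd_dvd1)
qed

text \<open>An isolated \<open>[a]\<close> coincides with the class of any prime divisor of \<open>gcd a N\<close>; conversely the
  only proper class dividing a prime is its own.\<close>

lemma Iso_D_ZFact: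
  "Iso (D (ZFact N)) = (\<lambda>q. ec (ZFact N) (ZMod N q)) `
     {q. Factorial_Ring.prime q \<and> q dvd N \<and> \<not> N dvd q}"
  (is "_ = ?e ` ?Q")
proof -
  have sub: "?e a \<in> ?e ` ?Q"
    if a: "gcd a N \<noteq> 1" "\<not> N dvd a"
      and iso: "\<And>b. gcd b N \<noteq> 1 \<Longrightarrow> \<not> N dvd b \<Longrightarrow> gcd b N dvd a \<Longrightarrow> gcd a N dvd b" for a
  proof -
    obtain q where q: "Factorial_Ring.prime q" "q dvd N" "q dvd a" "gcd q N = q" "\<not> N dvd q"
      using prime_factor_of_gcd a by blast
    have q1: "gcd q N \<noteq> 1" using q by auto
    have "gcd a N dvd q" using iso[of q] q q1 by simp
    hence "?e a = ?e q" using ec_ZMod_eq_iff[OF a q1] q by simp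
    thus ?thesis using q by blast
  qed
  have sup: "gcd q N \<noteq> 1 \<and> (\<forall>b. gcd b N \<noteq> 1 \<longrightarrow> gcd b N dvd q \<longrightarrow> gcd q N dvd b)"
    if "q \<in> ?Q" for q
  proof -
    have "gcd q N = q" using that prime_ge_0_int[of q] by (simp add: gcd_proj1_iff)
    thus ?thesis using that prime_dvd_if_gcd_dvd_prime by auto
  qed
  show ?thesis
    unfolding Iso_D_ZFact_by_gcd
  proof (intro equalityI image_subsetI)
    fix a assume "a \<in> {a. gcd a N \<noteq> 1 \<and> \<not> N dvd a \<and>
         (\<forall>b. gcd b N \<noteq> 1 \<longrightarrow> \<not> N dvd b \<longrightarrow> gcd b N dvd a \<longrightarrow> gcd a N dvd b)}"
    thus "?e a \<in> ?e ` ?Q" by (intro sub) simp_all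
  next
    fix q assume "q \<in> ?Q"
    thus "?e q \<in> ?e ` {a. gcd a N \<noteq> 1 \<and> \<not> N dvd a \<and>
         (\<forall>b. gcd b N \<noteq> 1 \<longrightarrow> \<not> N dvd b \<longrightarrow> gcd b N dvd a \<longrightarrow> gcd a N dvd b)}"
      using sup[of q] by (intro imageI) simp
  qed
qed

text \<open>If \<open>q\<^sup>2\<close> is a divisor of \<open>N\<close> other than \<open>N\<close>, then its class is a second point in the basic set
  of \<open>q\<close>. Otherwise a divisor \<open>q ^ i\<close> of \<open>N\<close> with \<open>i \<ge> 2\<close> is \<open>N\<close> itself, that is, zero modulo
  \<open>N\<close>, so only \<open>i = 1\<close> remains. The sign of \<open>N\<close> is fixed because \<open>N = q\<^sup>2\<close> is meant up to
  units.\<close>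

lemma Iso_GD_ZFact:
  assumes "N \<ge> 0"
  shows "Iso (GD (ZFact N)) = (\<lambda>q. ec (ZFact N) (ZMod N q)) `
     {q. Factorial_Ring.prime q \<and> q dvd N \<and> \<not> N dvd q \<and> (q\<^sup>2 dvd N \<longrightarrow> N = q\<^sup>2)}"
  (is "_ = ?e ` ?Q")
proof -
  have sub: "?e a \<in> ?e ` ?Q"
    if a: "gcd a N \<noteq> 1" "\<not> N dvd a"
      and iso: "\<And>b j. gcd b N \<noteq> 1 \<Longrightarrow> \<not> N dvd b \<Longrightarrow> 1 \<le> j \<Longrightarrow> gcd b N dvd a ^ j \<Longrightarrow>
                  gcd a N dvd b \<and> gcd b N dvd a" for a
  proof -
    obtain q where q: "Factorial_Ring.prime q" "q dvd N" "q dvd a" "gcd q N = q" "\<not> N dvd q"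
      using prime_factor_of_gcd a by blast
    have q1: "gcd q N \<noteq> 1" using q by auto
    have aq: "gcd a N dvd q" using iso[of q 1] q q1 by simp
    hence "?e a = ?e q" using ec_ZMod_eq_iff[OF a q1] q by simp
    moreover have "N = q\<^sup>2" if sq: "q\<^sup>2 dvd N"
    proof (rule ccontr)
      assume "N \<noteq> q\<^sup>2"
      hence "\<not> N dvd q\<^sup>2" using zdvd_antisym_nonneg[OF assms zero_le_power2 _ sq] by blast
      moreover have g: "gcd (q\<^sup>2) N = q\<^sup>2" using sq by (simp add: gcd_proj1_iff)
      moreover have "gcd (q\<^sup>2) N dvd a\<^sup>2" using g q by (simp add: dvd_power_same)
      moreover have "gcd (q\<^sup>2) N \<noteq> 1" using g prime_gt_1_int[OF q(1)]
        by (simp add: power2_eq_1_iff)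
      \<comment> \<open>The square divides \<open>a\<^sup>2\<close>, so it is in the basic set of \<open>a\<close> and must be associated to \<open>a\<close>.\<close>
      ultimately have "gcd (q\<^sup>2) N dvd a" using iso[of "q\<^sup>2" 2] by simp
      hence "q\<^sup>2 dvd gcd a N" using g sq by simp
      hence "q ^ 2 dvd q ^ 1" using aq dvd_trans[of "q\<^sup>2" "gcd a N" q] by simp
      hence "is_unit q" using q(1) by (subst (asm) dvd_power_iff) auto
      thus False using q(1) not_prime_unit by blast
    qed
    ultimately show ?thesis using q by blast
  qed
  have sup: "gcd q N \<noteq> 1 \<and> (\<forall>b. gcd b N \<noteq> 1 \<longrightarrow> \<not> N dvd b \<longrightarrow>
      (\<forall>j\<ge>1. gcd b N dvd q ^ j \<longrightarrow> gcd q N dvd b \<and> gcd b N dvd q))"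
    if Q: "q \<in> ?Q" for q
  proof -
    have g: "gcd q N = q" using Q prime_ge_0_int[of q] by (simp add: gcd_proj1_iff)
    have bq: "gcd b N = q" if b: "gcd b N \<noteq> 1" "\<not> N dvd b" "gcd b N dvd q ^ j" for b j
    proof -
      obtain i where i: "gcd b N = q ^ i"
        using b(3) Q divides_primepow[of q "gcd b N" j] by auto
      have "i \<noteq> 0" using i b(1) by (metis power_0)
      moreover have "\<not> i \<ge> 2"
      proof
        assume "i \<ge> 2"
        hence "q\<^sup>2 dvd gcd b N" using i by (simp add: le_imp_power_dvd)
        moreover from this have "q\<^sup>2 dvd N" by simp
        ultimately have "N dvd gcd b N" using Q by auto
        thus False using b(2) by simp
      qed
      ultimately have "i = 1" by simp
      thus ?thesis using i by simp
    qed
    have "gcd q N dvd b \<and> gcd b N dvd q"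
      if "gcd b N \<noteq> 1" "\<not> N dvd b" "gcd b N dvd q ^ j" for b j
      using gcd_dvd1[of b N] unfolding bq[OF that] g by simp
    moreover have "gcd q N \<noteq> 1" using g Q by auto
    ultimately show ?thesis by blast
  qed
  show ?thesis
    unfolding Iso_GD_ZFact_by_gcd
  proof (intro equalityI image_subsetI)
    fix a assume "a \<in> {a. gcd a N \<noteq> 1 \<and> \<not> N dvd a \<and>
         (\<forall>b. gcd b N \<noteq> 1 \<longrightarrow> \<not> N dvd b \<longrightarrow>
            (\<forall>j\<ge>1. gcd b N dvd a ^ j \<longrightarrow> gcd a N dvd b \<and> gcd b N dvd a))}"
    thus "?e a \<in> ?e ` ?Q" by (intro sub) simp_all
  next
    fix q assume "q \<in> ?Q"
    thus "?e q \<in> ?e ` {a. gcd a N \<noteq> 1 \<and> \<not> N dvd a \<and>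
         (\<forall>b. gcd b N \<noteq> 1 \<longrightarrow> \<not> N dvd b \<longrightarrow>
            (\<forall>j\<ge>1. gcd b N dvd a ^ j \<longrightarrow> gcd a N dvd b \<and> gcd b N dvd a))}"
      using sup[of q] by (intro imageI) simp
  qed
qed

section \<open>Evaluation at a prime factorization\<close>

lemma int_prime_divisors_eq:
  "{q. Factorial_Ring.prime q \<and> q dvd int n \<and> P q} =
     int ` {q. Factorial_Ring.prime q \<and> q dvd n \<and> P (int q)}"
proof (intro equalityI subsetI)
  fix q assume q: "q \<in> {q. Factorial_Ring.prime q \<and> q dvd int n \<and> P q}"
  hence "q \<ge> 0" by (simp add: prime_ge_0_int)
  then obtain r where "q = int r" by (rule nonneg_int_cases)
  thus "q \<in> int ` {q. Factorial_Ring.prime q \<and> q dvd n \<and> P (int q)}"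
    using q by simp
qed auto

lemma prime_dvd_prod_prime_powers_iff:
  fixes p m :: "nat \<Rightarrow> nat"
  assumes "finite I" "\<And>i. i \<in> I \<Longrightarrow> Factorial_Ring.prime (p i)"
    and "\<And>i. i \<in> I \<Longrightarrow> m i \<ge> 1" "Factorial_Ring.prime q"
  shows "q dvd (\<Prod>i\<in>I. p i ^ m i) \<longleftrightarrow> q \<in> p ` I"
proof
  assume "q dvd (\<Prod>i\<in>I. p i ^ m i)"
  then obtain i where "i \<in> I" "q dvd p i ^ m i"
    using assms by (auto simp: prime_dvd_prod_iff)
  thus "q \<in> p ` I" using assms prime_dvd_power primes_dvd_imp_eq by blast
next
  assume "q \<in> p ` I"
  then obtain i where "i \<in> I" "q = p i" by blast
  thus "q dvd (\<Prod>i\<in>I. p i ^ m i)"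
    using assms by (metis dvd_power dvd_prodI dvd_trans less_le_trans zero_less_one)
qed

lemma prime_square_dvd_prod_prime_powers_iff:
  fixes p m :: "nat \<Rightarrow> nat"
  assumes "finite I" "\<And>i. i \<in> I \<Longrightarrow> Factorial_Ring.prime (p i)"
    and "inj_on p I" "i \<in> I"
  shows "(p i)\<^sup>2 dvd (\<Prod>i\<in>I. p i ^ m i) \<longleftrightarrow> 2 \<le> m i"
proof -
  have nz: "p j ^ m j \<noteq> 0" if "j \<in> I" for j
    using prime_gt_0_nat[OF assms(2)[OF that]] by simp
  have mult: "multiplicity (p i) (p j ^ m j) = (if i = j then m j else 0)" if j: "j \<in> I" for j
  proof (cases "i = j")
    case True
    thus ?thesis using assms(2)[OF j] by (simp add: multiplicity_same_power prime_gt_0_nat)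
  next
    case False
    hence "p i \<noteq> p j" using assms(3,4) j by (simp add: inj_on_eq_iff)
    thus ?thesis
      using False multiplicity_distinct_prime_power[OF assms(2)[OF assms(4)] assms(2)[OF j]] by simp
  qed
  have "0 \<notin> (\<lambda>j. p j ^ m j) ` I"
  proof
    assume "0 \<in> (\<lambda>j. p j ^ m j) ` I"
    then obtain j where "0 = p j ^ m j" "j \<in> I" by (rule imageE)
    thus False using nz by metis
  qed
  hence "multiplicity (p i) (\<Prod>i\<in>I. p i ^ m i) = (\<Sum>j\<in>I. multiplicity (p i) (p j ^ m j))"
    by (rule prime_elem_multiplicity_prod_distrib[OF prime_imp_prime_elem[OF assms(2)[OF assms(4)]]
          _ assms(1)])
  also have "\<dots> = m i" using mult assms(1,4) by simp
  finally have "multiplicity (p i) (\<Prod>i\<in>I. p i ^ m i) = m i" .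
  moreover have "(\<Prod>i\<in>I. p i ^ m i) \<noteq> 0" using nz assms(1) by simp
  moreover have "\<not> is_unit (p i)" using assms(2)[OF assms(4)] not_prime_unit by blast
  ultimately show ?thesis by (simp add: power_dvd_iff_le_multiplicity)
qed

theorem theorem3p5:
  fixes k n :: nat and p m :: "nat \<Rightarrow> nat"
  assumes "k \<ge> 1"
    and "\<And>i. i \<in> {1..k} \<Longrightarrow> Factorial_Ring.prime (p i)"
    and "inj_on p {1..k}"
    and "\<And>i. i \<in> {1..k} \<Longrightarrow> m i \<ge> 1"
    and "n = (\<Prod>i\<in>{1..k}. p i ^ m i)"
  shows
    "(k = 1 \<longrightarrow>
        (m 1 = 2 \<longrightarrow> Iso (GD (ZFact (int n))) = {ec (ZFact (int n)) (ZMod (int n) (int (p 1)))}) \<and>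
        (m 1 \<noteq> 2 \<longrightarrow> Iso (GD (ZFact (int n))) = {})) \<and>
     (k \<ge> 2 \<longrightarrow>
        Iso (GD (ZFact (int n))) =
          {ec (ZFact (int n)) (ZMod (int n) (int (p i))) | i. i \<in> {1..k} \<and> m i = 1}) \<and>
     (Factorial_Ring.prime n \<longrightarrow> Iso (D (ZFact (int n))) = {}) \<and>
     (\<not> Factorial_Ring.prime n \<longrightarrow>
        Iso (D (ZFact (int n))) =
          {ec (ZFact (int n)) (ZMod (int n) (int (p i))) | i. i \<in> {1..k}})"
proof -
  let ?I = "{1..k}" and ?e = "\<lambda>q. ec (ZFact (int n)) (ZMod (int n) (int q))"
  have dvd_iff: "q dvd n \<longleftrightarrow> q \<in> p ` ?I" if "Factorial_Ring.prime q" for q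
    unfolding assms(5) using prime_dvd_prod_prime_powers_iff[of ?I p m q] assms(2,4) that by blast
  have sq_iff: "(p i)\<^sup>2 dvd n \<longleftrightarrow> 2 \<le> m i" if "i \<in> ?I" for i
    unfolding assms(5) using prime_square_dvd_prod_prime_powers_iff[of ?I p i m] assms(2,3) that
    by blast
  have proper: "\<not> n dvd q \<longleftrightarrow> n \<noteq> q" if "q dvd n" for q
    using that dvd_antisym by blast
  have D: "Iso (D (ZFact (int n))) = (?e \<circ> p) ` {i \<in> ?I. n \<noteq> p i}"
  proof -
    have "{q. Factorial_Ring.prime q \<and> q dvd n \<and> \<not> n dvd q} = p ` {i \<in> ?I. n \<noteq> p i}"
      using dvd_iff proper assms(2) by auto
    thus ?thesis
      by (simp add: Iso_D_ZFact int_prime_divisors_eq image_image int_dvd_int_iff flip: image_comp)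
  qed
  have GD: "Iso (GD (ZFact (int n))) =
      (?e \<circ> p) ` {i \<in> ?I. n \<noteq> p i \<and> (2 \<le> m i \<longrightarrow> n = (p i)\<^sup>2)}"
  proof -
    have "{q. Factorial_Ring.prime q \<and> q dvd n \<and> \<not> n dvd q \<and> (q\<^sup>2 dvd n \<longrightarrow> n = q\<^sup>2)} =
        p ` {i \<in> ?I. n \<noteq> p i \<and> ((p i)\<^sup>2 dvd n \<longrightarrow> n = (p i)\<^sup>2)}"
      using dvd_iff proper assms(2) by blast
    moreover have "{i \<in> ?I. n \<noteq> p i \<and> ((p i)\<^sup>2 dvd n \<longrightarrow> n = (p i)\<^sup>2)} =
        {i \<in> ?I. n \<noteq> p i \<and> (2 \<le> m i \<longrightarrow> n = (p i)\<^sup>2)}"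
      using sq_iff by blast
    moreover have "(int q)\<^sup>2 dvd int n \<longleftrightarrow> q\<^sup>2 dvd n" "int n = (int q)\<^sup>2 \<longleftrightarrow> n = q\<^sup>2" for q
      by (simp_all only: of_nat_eq_iff int_dvd_int_iff flip: of_nat_power)
    ultimately show ?thesis
      by (simp add: Iso_GD_ZFact int_prime_divisors_eq image_image int_dvd_int_iff flip: image_comp)
  qed
  have one: "(n = p 1 \<longleftrightarrow> m 1 = 1) \<and> (n = (p 1)\<^sup>2 \<longleftrightarrow> m 1 = 2)" if "k = 1"
  proof -
    have "n = p 1 ^ m 1" "p 1 > 1" using assms(2)[of 1] assms(5) that prime_gt_1_nat by auto
    thus ?thesis using power_inject_exp[of "p 1" "m 1" 1] power_inject_exp[of "p 1" "m 1" 2]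
      by simp
  qed
  have two: "n \<noteq> p i ^ j" if "2 \<le> k" "i \<in> ?I" for i j
  proof
    assume n: "n = p i ^ j"
    have "(if i = 1 then 2 else 1) \<in> ?I - {i}" using \<open>2 \<le> k\<close> by auto
    then obtain l where l: "l \<in> ?I" "l \<noteq> i" by blast
    note prime_l = assms(2)[OF l(1)]
    have "p l dvd p i ^ j" using dvd_iff[OF prime_l] l(1) n by auto
    hence "p l dvd p i" using prime_l prime_dvd_power by blast
    hence "p l = p i" using primes_dvd_imp_eq[OF prime_l assms(2)[OF that(2)]] by blast
    thus False using l that(2) assms(3) by (auto simp: inj_on_eq_iff)
  qed
  have "Iso (GD (ZFact (int n))) = (if m 1 = 2 then {?e (p 1)} else {})" if "k = 1"
  proof -
    have "i \<in> ?I \<and> n \<noteq> p i \<and> (2 \<le> m i \<longrightarrow> n = (p i)\<^sup>2) \<longleftrightarrow> i = 1 \<and> m 1 = 2" for i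
    proof (cases "i = 1")
      case True
      have "1 \<in> ?I" using \<open>k = 1\<close> by simp
      thus ?thesis using True one[OF \<open>k = 1\<close>] assms(4)[of 1] by auto
    qed (use \<open>k = 1\<close> in auto)
    hence "{i \<in> ?I. n \<noteq> p i \<and> (2 \<le> m i \<longrightarrow> n = (p i)\<^sup>2)} = (if m 1 = 2 then {1} else {})"
      by auto
    thus ?thesis unfolding GD by simp
  qed
  moreover have "Iso (GD (ZFact (int n))) = {?e (p i) | i. i \<in> ?I \<and> m i = 1}" if "2 \<le> k"
  proof -
    have "n \<noteq> p i \<and> (2 \<le> m i \<longrightarrow> n = (p i)\<^sup>2) \<longleftrightarrow> m i = 1" if "i \<in> ?I" for i
      using two[OF \<open>2 \<le> k\<close> that, of 1] two[OF \<open>2 \<le> k\<close> that, of 2] assms(4)[OF that] by auto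
    hence "{i \<in> ?I. n \<noteq> p i \<and> (2 \<le> m i \<longrightarrow> n = (p i)\<^sup>2)} = {i \<in> ?I. m i = 1}"
      by blast
    thus ?thesis unfolding GD by auto
  qed
  moreover have "Iso (D (ZFact (int n))) = {}" if "Factorial_Ring.prime n"
  proof -
    have "n = p i" if "i \<in> ?I" for i
      using dvd_iff[OF assms(2)[OF that]] that
        primes_dvd_imp_eq[OF assms(2)[OF that] \<open>Factorial_Ring.prime n\<close>] by auto
    thus ?thesis unfolding D by blast
  qed
  moreover have "Iso (D (ZFact (int n))) = {?e (p i) | i. i \<in> ?I}" if "\<not> Factorial_Ring.prime n"
  proof -
    have "{i \<in> ?I. n \<noteq> p i} = ?I" using assms(2) that by auto
    thus ?thesis unfolding D by auto
  qed
  ultimately show ?thesis by simp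
qed

end
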